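(* Let $1\le i_1<i_2<\cdots<i_n=m$ be integers such that, setting $i_0:=0$, there exists $j\in\{1,\ldots,n\}$ with $i_j\ne i_{j-1}+1$. Let $I=\{i_1,\ldots,i_n\}$ and let $S_I:=\sum_{h=1}^n s_{i_h}$, acting on the discrete monotone Fock space. Then $$\|S_I\|=R_n,$$ where $R_n:=\max A_n$ is the largest atom of the vacuum distribution of $S_n=\sum_{i=1}^n s_i$, the sets $A_k$ being defined by $A_1=\{1,-1\}$ and $A_{k+1}=\big\{\tfrac12\big(r\pm\sqrt{r^2+4}\big): r\in A_k\big\}$ for $k\ge1$.
   Context: $\mathbb{N}=\{1,2,3,\ldots\}$. For $k\ge1$ let $I_k:=\{(i_1,\ldots,i_k): i_1<i_2<\cdots<i_k,\ i_j\in\mathbb{N}\}$. The discrete monotone Fock space is the Hilbert space $\mathcal{F}:=\bigoplus_{k\ge0}\mathcal{H}_k$, with $\mathcal{H}_0=\mathbb{C}\Omega$ ($\Omega$ a unit vector, the vacuum) and $\mathcal{H}_k=\ell^2(I_k)$ for $k\ge1$; its canonical orthonormal basis consists of $\Omega$ and the vectors $e_{(i_1,\ldots,i_k)}$, $(i_1,\ldots,i_k)\in I_k$, $k\ge 1$ (write $e_i=e_{(i)}$). For $i\in\mathbb{N}$ the monotone creation operator $a_i^\dagger$ and annihilation operator $a_i$ are the bounded, mutually adjoint operators with $a_i^\dagger\Omega=e_i$, $a_i\Omega=0$; $a_i^\dagger e_{(i_1,\ldots,i_k)}=e_{(i,i_1,\ldots,i_k)}$ if $i<i_1$ and $0$ otherwise;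 $a_i e_{(i_1,\ldots,i_k)}=e_{(i_2,\ldots,i_k)}$ if $i=i_1$ and $0$ otherwise (with $a_ie_i=\Omega$). The position operator is $s_i:=a_i+a_i^\dagger$. The vacuum distribution of $S_n$ is the unique compactly supported probability measure $\mu_n$ on $\mathbb{R}$ with $\int x^p\,\mu_n(dx)=\langle S_n^p\Omega,\Omega\rangle$ for all $p\ge0$; $A_n$ is the set of its atoms. *)

theory Defs
  imports "HOL-Probability.Probability"
begin

text \<open>
  The canonical basis of the Fock space is indexed by the strictly increasing finite sequences of
  positive integers. The empty sequence is included and indexes the vacuum vector, so that the
  Hilbert sum of $\mathbb{C}\Omega$ and the spaces $\ell^2(I_k)$, $k \ge 1$, is the space of
  square-summable complex families on this index set. Such families are represented as functions
  on all lists that vanish outside the index set.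
\<close>

definition mono_words :: "nat list set" where
  "mono_words = {w. sorted_wrt (<) w \<and> (\<forall>i\<in>set w. 1 \<le> i)}"

lemma Nil_mono_words [simp]: "[] \<in> mono_words"
  by (simp add: mono_words_def)

lemma Cons_mono_words:
  "i # w \<in> mono_words \<longleftrightarrow> 1 \<le> i \<and> w \<in> mono_words \<and> (w = [] \<or> i < hd w)"
  by (cases w) (auto simp: mono_words_def)

typedef fock =
  "{f :: nat list \<Rightarrow> complex.
      (\<forall>w. w \<notin> mono_words \<longrightarrow> f w = 0) \<and> (\<lambda>w. (cmod (f w))\<^sup>2) summable_on UNIV}"
  morphisms fock_coeff Abs_fock
  by (rule exI[of _ "\<lambda>_. 0"]) simp

setup_lifting type_definition_fock

lemma fock_coeff_outside: "w \<notin> mono_words \<Longrightarrow> fock_coeff \<psi> w = 0"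
  using fock_coeff[of \<psi>] by blast

lemma summable_coeff: "(\<lambda>w. (cmod (fock_coeff \<psi> w))\<^sup>2) summable_on UNIV"
  using fock_coeff[of \<psi>] by blast

lemma fock_eqI: "(\<And>w. fock_coeff \<psi> w = fock_coeff \<phi> w) \<Longrightarrow> \<psi> = \<phi>"
  by (metis ext fock_coeff_inject)

lemma square_summable_add:
  fixes f g :: "'a \<Rightarrow> complex"
  assumes "(\<lambda>w. (cmod (f w))\<^sup>2) summable_on A" "(\<lambda>w. (cmod (g w))\<^sup>2) summable_on A"
  shows "(\<lambda>w. (cmod (f w + g w))\<^sup>2) summable_on A"
proof (rule summable_on_comparison_test)
  show "(\<lambda>w. 2 * (cmod (f w))\<^sup>2 + 2 * (cmod (g w))\<^sup>2) summable_on A"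
    by (intro summable_on_add summable_on_cmult_right assms)
  show "(cmod (f w + g w))\<^sup>2 \<le> 2 * (cmod (f w))\<^sup>2 + 2 * (cmod (g w))\<^sup>2" for w
  proof -
    have "(cmod (f w + g w))\<^sup>2 \<le> (cmod (f w) + cmod (g w))\<^sup>2"
      by (intro power_mono norm_triangle_ineq) simp
    also have "\<dots> \<le> 2 * (cmod (f w))\<^sup>2 + 2 * (cmod (g w))\<^sup>2"
      using zero_le_power2[of "cmod (f w) - cmod (g w)"]
      by (simp add: power2_eq_square algebra_simps)
    finally show ?thesis .
  qed
qed auto

lemma square_summable_cmult:
  fixes f :: "'a \<Rightarrow> complex"
  assumes "(\<lambda>w. (cmod (f w))\<^sup>2) summable_on A"
  shows "(\<lambda>w. (cmod (c * f w))\<^sup>2) summable_on A"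
  using summable_on_cmult_right[OF assms, of "(cmod c)\<^sup>2"]
  by (simp add: norm_mult power_mult_distrib)

lemma square_summable_mult_cnj:
  fixes f g :: "'a \<Rightarrow> complex"
  assumes "(\<lambda>w. (cmod (f w))\<^sup>2) summable_on A" "(\<lambda>w. (cmod (g w))\<^sup>2) summable_on A"
  shows "(\<lambda>w. f w * cnj (g w)) summable_on A"
proof -
  have "(\<lambda>w. norm (f w * cnj (g w))) summable_on A"
    by (rule abs_summable_product) (use assms in \<open>simp_all add: norm_power power2_eq_square norm_mult\<close>)
  then show ?thesis
    by (rule abs_summable_summable)
qed

instantiation fock :: real_vector
begin

lift_definition zero_fock :: fock is "\<lambda>_. 0"
  by simp

lift_definition plus_fock :: "fock \<Rightarrow> fock \<Rightarrow> fock" is "\<lambda>f g w. f w + g w"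
  by (auto intro: square_summable_add)

lift_definition uminus_fock :: "fock \<Rightarrow> fock" is "\<lambda>f w. - f w"
  by simp

lift_definition minus_fock :: "fock \<Rightarrow> fock \<Rightarrow> fock" is "\<lambda>f g w. f w - g w"
  subgoal for f g using square_summable_add[of f UNIV "\<lambda>w. - g w"] by auto
  done

lift_definition scaleR_fock :: "real \<Rightarrow> fock \<Rightarrow> fock" is "\<lambda>r f w. complex_of_real r * f w"
  subgoal for r f using square_summable_cmult[of f UNIV "complex_of_real r"] by auto
  done

instance
  by standard (transfer; simp add: fun_eq_iff algebra_simps)+

end

lemma fock_coeff_zero [simp]: "fock_coeff 0 w = 0"
  by transfer simp

lemma fock_coeff_add [simp]: "fock_coeff (\<psi> + \<phi>) w = fock_coeff \<psi> w + fock_coeff \<phi> w"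
  by transfer simp

lemma fock_coeff_uminus [simp]: "fock_coeff (- \<psi>) w = - fock_coeff \<psi> w"
  by transfer simp

lemma fock_coeff_diff [simp]: "fock_coeff (\<psi> - \<phi>) w = fock_coeff \<psi> w - fock_coeff \<phi> w"
  by transfer simp

lemma fock_coeff_scaleR [simp]: "fock_coeff (r *\<^sub>R \<psi>) w = complex_of_real r * fock_coeff \<psi> w"
  by transfer simp

lift_definition cscale :: "complex \<Rightarrow> fock \<Rightarrow> fock" is "\<lambda>c f w. c * f w"
  subgoal for c f using square_summable_cmult[of f UNIV c] by auto
  done

lemma fock_coeff_cscale [simp]: "fock_coeff (cscale c \<psi>) w = c * fock_coeff \<psi> w"
  by transfer simp

definition cinner :: "fock \<Rightarrow> fock \<Rightarrow> complex" where
  "cinner \<psi> \<phi> = (\<Sum>\<^sub>\<infinity>w. fock_coeff \<psi> w * cnj (fock_coeff \<phi> w))"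

lemma summable_cinner: "(\<lambda>w. fock_coeff \<psi> w * cnj (fock_coeff \<phi> w)) summable_on UNIV"
  by (intro square_summable_mult_cnj summable_coeff)

lemma cinner_add_left: "cinner (\<psi> + \<xi>) \<phi> = cinner \<psi> \<phi> + cinner \<xi> \<phi>"
  unfolding cinner_def fock_coeff_add distrib_right by (intro infsum_add summable_cinner)

lemma cinner_cscale_left: "cinner (cscale c \<psi>) \<phi> = c * cinner \<psi> \<phi>"
  unfolding cinner_def fock_coeff_cscale mult.assoc by (intro infsum_cmult_right summable_cinner)

lemma cinner_commute: "cinner \<phi> \<psi> = cnj (cinner \<psi> \<phi>)"
  unfolding cinner_def infsum_cnj[symmetric] by (simp add: mult.commute)

lemma scaleR_eq_cscale: "r *\<^sub>R \<psi> = cscale (complex_of_real r) \<psi>"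
  by (rule fock_eqI) simp

lemma cinner_self: "cinner \<psi> \<psi> = complex_of_real (\<Sum>\<^sub>\<infinity>w. (cmod (fock_coeff \<psi> w))\<^sup>2)"
proof -
  have "(\<Sum>\<^sub>\<infinity>w. complex_of_real ((cmod (fock_coeff \<psi> w))\<^sup>2)) = complex_of_real (\<Sum>\<^sub>\<infinity>w. (cmod (fock_coeff \<psi> w))\<^sup>2)"
    by (intro infsumI has_sum_of_real has_sum_infsum summable_coeff)
  then show ?thesis
    by (simp only: cinner_def complex_norm_square)
qed

text \<open>
  The library's inner product spaces are real; the real inner product below is the real part of
  the complex one, and both induce the same norm.
\<close>

instantiation fock :: real_inner
begin

definition inner_fock :: "fock \<Rightarrow> fock \<Rightarrow> real" where
  "inner_fock \<psi> \<phi> = Re (cinner \<psi> \<phi>)"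

definition norm_fock :: "fock \<Rightarrow> real" where
  "norm_fock \<psi> = sqrt (\<Sum>\<^sub>\<infinity>w. (cmod (fock_coeff \<psi> w))\<^sup>2)"

definition sgn_fock :: "fock \<Rightarrow> fock" where
  "sgn_fock \<psi> = \<psi> /\<^sub>R norm \<psi>"

definition dist_fock :: "fock \<Rightarrow> fock \<Rightarrow> real" where
  "dist_fock \<psi> \<phi> = norm (\<psi> - \<phi>)"

definition uniformity_fock :: "(fock \<times> fock) filter" where
  "uniformity_fock = (INF e\<in>{0<..}. principal {(\<psi>, \<phi>). dist \<psi> \<phi> < e})"

definition open_fock :: "fock set \<Rightarrow> bool" where
  "open_fock U = (\<forall>\<psi>\<in>U. eventually (\<lambda>(\<psi>', \<phi>). \<psi>' = \<psi> \<longrightarrow> \<phi> \<in> U) uniformity)"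

instance
proof
  fix \<psi> \<phi> \<xi> :: fock and r :: real and U :: "fock set"
  show "inner \<psi> \<phi> = inner \<phi> \<psi>"
    unfolding inner_fock_def by (subst cinner_commute) simp
  show "inner (\<psi> + \<xi>) \<phi> = inner \<psi> \<phi> + inner \<xi> \<phi>"
    by (simp add: inner_fock_def cinner_add_left)
  show "inner (r *\<^sub>R \<psi>) \<phi> = r * inner \<psi> \<phi>"
    by (simp add: inner_fock_def scaleR_eq_cscale cinner_cscale_left)
  show "0 \<le> inner \<psi> \<psi>"
    by (simp add: inner_fock_def cinner_self infsum_nonneg)
  show "inner \<psi> \<psi> = 0 \<longleftrightarrow> \<psi> = 0"
  proof
    assume "inner \<psi> \<psi> = 0"
    then have "(\<Sum>\<^sub>\<infinity>w. (cmod (fock_coeff \<psi> w))\<^sup>2) = 0"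
      by (simp add: inner_fock_def cinner_self)
    then have "(cmod (fock_coeff \<psi> w))\<^sup>2 = 0" for w
      using nonneg_infsum_le_0D[of "\<lambda>w. (cmod (fock_coeff \<psi> w))\<^sup>2" UNIV w] summable_coeff[of \<psi>] by simp
    then show "\<psi> = 0"
      by (intro fock_eqI) simp
  qed (simp add: inner_fock_def cinner_def)
  show "norm \<psi> = sqrt (inner \<psi> \<psi>)"
    by (simp add: norm_fock_def inner_fock_def cinner_self)
qed (simp_all add: sgn_fock_def dist_fock_def uniformity_fock_def open_fock_def)

end

lemma norm_fock_square: "(norm \<psi>)\<^sup>2 = (\<Sum>\<^sub>\<infinity>w. (cmod (fock_coeff \<psi> w))\<^sup>2)"
  by (simp add: norm_fock_def infsum_nonneg)

lemma norm_eq_sqrt_cinner: "norm \<psi> = sqrt (cmod (cinner \<psi> \<psi>))"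
  by (simp add: norm_fock_def cinner_self infsum_nonneg)

lemma sum_coeff_le_norm:
  assumes "finite F"
  shows "(\<Sum>w\<in>F. (cmod (fock_coeff \<psi> w))\<^sup>2) \<le> (norm \<psi>)\<^sup>2"
  unfolding norm_fock_square
  by (rule finite_sum_le_infsum) (use assms summable_coeff in auto)

lemma norm_fock_leI:
  assumes "\<And>F. finite F \<Longrightarrow> (\<Sum>w\<in>F. (cmod (fock_coeff \<psi> w))\<^sup>2) \<le> B\<^sup>2" "0 \<le> B"
  shows "norm \<psi> \<le> B"
proof -
  have "(norm \<psi>)\<^sup>2 \<le> B\<^sup>2"
    unfolding norm_fock_square
    by (rule infsum_le_finite_sums) (use assms summable_coeff in auto)
  then show ?thesis
    using assms(2) by (rule power2_le_imp_le)
qed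

lemma coeff_le_norm: "cmod (fock_coeff \<psi> w) \<le> norm \<psi>"
  using sum_coeff_le_norm[of "{w}" \<psi>] by (auto intro: power2_le_imp_le)

instance fock :: banach
proof
  fix X :: "nat \<Rightarrow> fock"
  assume X: "Cauchy X"
  have "Cauchy (\<lambda>n. fock_coeff (X n) w)" for w
  proof (rule CauchyI)
    fix e :: real
    assume "0 < e"
    with X obtain N where "\<forall>m\<ge>N. \<forall>n\<ge>N. norm (X m - X n) < e"
      by (meson CauchyD)
    then show "\<exists>N. \<forall>m\<ge>N. \<forall>n\<ge>N. norm (fock_coeff (X m) w - fock_coeff (X n) w) < e"
      using le_less_trans[OF coeff_le_norm[of "X _ - X _" w]] by (metis fock_coeff_diff)
  qed
  then have "\<exists>l. (\<lambda>n. fock_coeff (X n) w) \<longlonglongrightarrow> l" for w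
    by (simp add: Cauchy_convergent_iff convergent_def)
  then obtain f where f: "\<And>w. (\<lambda>n. fock_coeff (X n) w) \<longlonglongrightarrow> f w"
    by metis
  have f_outside: "f w = 0" if "w \<notin> mono_words" for w
    using f[of w] that by (simp add: fock_coeff_outside LIMSEQ_const_iff)
  obtain B where B: "\<And>n. norm (X n) \<le> B" "0 \<le> B"
    using Cauchy_Bseq[OF X] by (meson BseqE less_imp_le)
  have "(\<lambda>w. (cmod (f w))\<^sup>2) summable_on UNIV"
  proof (rule nonneg_bounded_partial_sums_imp_summable_on)
    show "eventually (\<lambda>F. (\<Sum>w\<in>F. (cmod (f w))\<^sup>2) \<le> B\<^sup>2) (finite_subsets_at_top UNIV)"
    proof (rule eventually_finite_subsets_at_top_weakI)
      fix F :: "nat list set"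
      assume F: "finite F"
      have "(\<lambda>n. \<Sum>w\<in>F. (cmod (fock_coeff (X n) w))\<^sup>2) \<longlonglongrightarrow> (\<Sum>w\<in>F. (cmod (f w))\<^sup>2)"
        by (intro tendsto_intros f)
      moreover have "(\<Sum>w\<in>F. (cmod (fock_coeff (X n) w))\<^sup>2) \<le> B\<^sup>2" for n
        using sum_coeff_le_norm[OF F, of "X n"] power_mono[OF B(1)[of n], of 2] by simp
      ultimately show "(\<Sum>w\<in>F. (cmod (f w))\<^sup>2) \<le> B\<^sup>2"
        by (intro LIMSEQ_le_const2) auto
    qed
  qed auto
  then have coeff_f: "fock_coeff (Abs_fock f) w = f w" for w
    by (subst Abs_fock_inverse) (auto simp: f_outside)
  have "X \<longlonglongrightarrow> Abs_fock f"
  proof (rule LIMSEQ_I)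
    fix e :: real
    assume e: "0 < e"
    then obtain N where N: "\<And>m n. m \<ge> N \<Longrightarrow> n \<ge> N \<Longrightarrow> norm (X m - X n) < e / 2"
      using CauchyD[OF X, of "e / 2"] by auto
    have "norm (X n - Abs_fock f) \<le> e / 2" if n: "n \<ge> N" for n
    proof (rule norm_fock_leI)
      fix F :: "nat list set"
      assume F: "finite F"
      have "(\<lambda>m. \<Sum>w\<in>F. (cmod (fock_coeff (X n) w - fock_coeff (X m) w))\<^sup>2)
              \<longlonglongrightarrow> (\<Sum>w\<in>F. (cmod (fock_coeff (X n) w - f w))\<^sup>2)"
        by (intro tendsto_intros f)
      moreover have "(\<Sum>w\<in>F. (cmod (fock_coeff (X n) w - fock_coeff (X m) w))\<^sup>2) \<le> (e / 2)\<^sup>2" if "m \<ge> N" for m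
        using sum_coeff_le_norm[OF F, of "X n - X m"]
          power_mono[OF less_imp_le[OF N[OF n that]], of 2] by simp
      ultimately show "(\<Sum>w\<in>F. (cmod (fock_coeff (X n - Abs_fock f) w))\<^sup>2) \<le> (e / 2)\<^sup>2"
        unfolding fock_coeff_diff coeff_f by (intro LIMSEQ_le_const2) auto
    qed (use e in simp)
    then show "\<exists>N. \<forall>n\<ge>N. norm (X n - Abs_fock f) < e"
      using e by (intro exI[of _ N]) force
  qed
  then show "convergent X"
    by (rule convergentI)
qed


text \<open>The basis vector of an index; lists that are not indices give the zero vector.\<close>

lift_definition ket :: "nat list \<Rightarrow> fock" is
  "\<lambda>v w. if w = v \<and> v \<in> mono_words then 1 else 0"
  subgoal for v
  proof (intro conjI allI impI)
    show "(\<lambda>w. (cmod (if w = v \<and> v \<in> mono_words then 1 else 0))\<^sup>2) summable_on UNIV"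
      using summable_on_cong_neutral[of UNIV "{v}" "\<lambda>w. (cmod (if w = v \<and> v \<in> mono_words then 1 else 0))\<^sup>2"
          "\<lambda>w. (cmod (if w = v \<and> v \<in> mono_words then 1 else 0))\<^sup>2"] by simp
  qed auto
  done

lemma fock_coeff_ket: "fock_coeff (ket v) w = (if w = v \<and> v \<in> mono_words then 1 else 0)"
  by transfer simp

lemma cinner_ket_right: "v \<in> mono_words \<Longrightarrow> cinner \<psi> (ket v) = fock_coeff \<psi> v"
proof -
  assume v: "v \<in> mono_words"
  have "cinner \<psi> (ket v) = (\<Sum>\<^sub>\<infinity>w\<in>{v}. fock_coeff \<psi> w)"
    unfolding cinner_def by (rule infsum_cong_neutral) (auto simp: fock_coeff_ket v)
  then show ?thesis
    by simp
qed

text \<open>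
  The following two lemmas say that the basis vectors form an orthonormal basis.
\<close>

lemma cinner_ket_ket:
  "v \<in> mono_words \<Longrightarrow> w \<in> mono_words \<Longrightarrow> cinner (ket v) (ket w) = (if v = w then 1 else 0)"
  by (auto simp: cinner_ket_right fock_coeff_ket)

lemma ket_total: "(\<And>w. w \<in> mono_words \<Longrightarrow> cinner \<psi> (ket w) = 0) \<Longrightarrow> \<psi> = 0"
  by (rule fock_eqI) (metis cinner_ket_right fock_coeff_outside fock_coeff_zero)

definition vacuum :: fock where
  "vacuum = ket []"

lemma norm_vacuum: "norm vacuum = 1"
  by (simp add: vacuum_def norm_eq_sqrt_cinner cinner_ket_ket)

text \<open>
  The creation and annihilation operators are given by their coefficients; the lemmas below
  show that they are complex-linear and bounded, act on the basis vectors as expected, and are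
  adjoint to each other. For \<open>i = 0\<close>, which is not a mode of the Fock space, both are zero.
\<close>

lemma square_summable_create:
  assumes "(\<lambda>w. (cmod (f w))\<^sup>2) summable_on UNIV"
  shows "(\<lambda>w. (cmod (if w \<in> mono_words \<and> w \<noteq> [] \<and> hd w = i then f (tl w) else 0))\<^sup>2) summable_on UNIV"
    (is "?g summable_on UNIV")
proof -
  have "(\<lambda>w. (cmod (f (tl w)))\<^sup>2) summable_on range (Cons i)"
    using assms by (subst summable_on_reindex) (auto simp: o_def)
  then have "?g summable_on range (Cons i)"
    by (rule summable_on_comparison_test) auto
  then show ?thesis
    by (rule summable_on_cong_neutral[THEN iffD1, rotated -1]) (auto simp: image_iff neq_Nil_conv)
qed

lemma square_summable_annihilate:
  fixes f :: "nat list \<Rightarrow> complex"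
  assumes "(\<lambda>w. (cmod (f w))\<^sup>2) summable_on UNIV"
  shows "(\<lambda>w. (cmod (f (i # w)))\<^sup>2) summable_on UNIV"
  using summable_on_reindex[of "Cons i" UNIV "\<lambda>w. (cmod (f w))\<^sup>2"]
    summable_on_subset_banach[OF assms, of "range (Cons i)"]
  by (simp add: o_def)

lift_definition create :: "nat \<Rightarrow> fock \<Rightarrow> fock" is
  "\<lambda>i f w. if w \<in> mono_words \<and> w \<noteq> [] \<and> hd w = i then f (tl w) else 0"
  using square_summable_create by auto

lift_definition annihilate :: "nat \<Rightarrow> fock \<Rightarrow> fock" is "\<lambda>i f w. f (i # w)"
  using square_summable_annihilate by (auto simp: Cons_mono_words)

lemma fock_coeff_create:
  "fock_coeff (create i \<psi>) w =
    (if w \<in> mono_words \<and> w \<noteq> [] \<and> hd w = i then fock_coeff \<psi> (tl w) else 0)"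
  by transfer simp

lemma fock_coeff_annihilate: "fock_coeff (annihilate i \<psi>) w = fock_coeff \<psi> (i # w)"
  by transfer simp

lemma norm_create_le: "norm (create i \<psi>) \<le> norm \<psi>"
proof (rule norm_fock_leI)
  fix F :: "nat list set"
  assume F: "finite F"
  let ?G = "{w \<in> F. w \<in> mono_words \<and> w \<noteq> [] \<and> hd w = i}"
  have inj: "inj_on tl ?G"
    by (auto simp: inj_on_def neq_Nil_conv)
  have "(\<Sum>w\<in>F. (cmod (fock_coeff (create i \<psi>) w))\<^sup>2) = (\<Sum>w\<in>?G. (cmod (fock_coeff \<psi> (tl w)))\<^sup>2)"
    using F by (intro sum.mono_neutral_cong_right) (auto simp: fock_coeff_create)
  also have "\<dots> = (\<Sum>w\<in>tl ` ?G. (cmod (fock_coeff \<psi> w))\<^sup>2)"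
    by (simp add: sum.reindex[OF inj])
  also have "\<dots> \<le> (norm \<psi>)\<^sup>2"
    using F by (intro sum_coeff_le_norm) simp
  finally show "(\<Sum>w\<in>F. (cmod (fock_coeff (create i \<psi>) w))\<^sup>2) \<le> (norm \<psi>)\<^sup>2" .
qed simp

lemma norm_annihilate_le: "norm (annihilate i \<psi>) \<le> norm \<psi>"
proof (rule norm_fock_leI)
  fix F :: "nat list set"
  assume F: "finite F"
  have "(\<Sum>w\<in>F. (cmod (fock_coeff (annihilate i \<psi>) w))\<^sup>2) = (\<Sum>w\<in>Cons i ` F. (cmod (fock_coeff \<psi> w))\<^sup>2)"
    by (simp add: sum.reindex fock_coeff_annihilate)
  also have "\<dots> \<le> (norm \<psi>)\<^sup>2"
    using F by (intro sum_coeff_le_norm) simp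
  finally show "(\<Sum>w\<in>F. (cmod (fock_coeff (annihilate i \<psi>) w))\<^sup>2) \<le> (norm \<psi>)\<^sup>2" .
qed simp

lift_definition creation :: "nat \<Rightarrow> fock \<Rightarrow>\<^sub>L fock" is create
proof -
  fix i
  show "bounded_linear (create i)"
    by (rule bounded_linear_intro[where K = 1])
      (auto intro!: fock_eqI norm_create_le simp: fock_coeff_create)
qed

lift_definition annihilation :: "nat \<Rightarrow> fock \<Rightarrow>\<^sub>L fock" is annihilate
proof -
  fix i
  show "bounded_linear (annihilate i)"
    by (rule bounded_linear_intro[where K = 1])
      (auto intro!: fock_eqI norm_annihilate_le simp: fock_coeff_annihilate)
qed

lemma creation_cscale: "creation i (cscale c \<psi>) = cscale c (creation i \<psi>)"
  by transfer (auto intro!: fock_eqI simp: fock_coeff_create)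

lemma annihilation_cscale: "annihilation i (cscale c \<psi>) = cscale c (annihilation i \<psi>)"
  by transfer (auto intro!: fock_eqI simp: fock_coeff_annihilate)

lemma creation_vacuum: "1 \<le> i \<Longrightarrow> creation i vacuum = ket [i]"
proof (rule fock_eqI)
  fix w
  assume "1 \<le> i"
  then show "fock_coeff (creation i vacuum) w = fock_coeff (ket [i]) w"
    by (cases w)
      (auto simp: vacuum_def creation.rep_eq fock_coeff_create fock_coeff_ket Cons_mono_words)
qed

lemma creation_ket:
  assumes "1 \<le> i" "j # v \<in> mono_words"
  shows "creation i (ket (j # v)) = (if i < j then ket (i # j # v) else 0)"
proof (rule fock_eqI)
  fix w
  have "i # j # v \<in> mono_words \<longleftrightarrow> i < j"
    using assms by (simp add: Cons_mono_words[of i])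
  then show "fock_coeff (creation i (ket (j # v))) w =
      fock_coeff (if i < j then ket (i # j # v) else 0) w"
    using assms(2)
    by (cases w) (auto simp: creation.rep_eq fock_coeff_create fock_coeff_ket)
qed

lemma annihilation_vacuum: "annihilation i vacuum = 0"
  unfolding vacuum_def
  by transfer (auto intro!: fock_eqI simp: fock_coeff_annihilate fock_coeff_ket)

lemma annihilation_ket:
  assumes "j # v \<in> mono_words"
  shows "annihilation i (ket (j # v)) = (if i = j then ket v else 0)"
proof (rule fock_eqI)
  fix w
  have "v \<in> mono_words"
    using assms by (simp add: Cons_mono_words)
  then show "fock_coeff (annihilation i (ket (j # v))) w = fock_coeff (if i = j then ket v else 0) w"
    using assms by (auto simp: annihilation.rep_eq fock_coeff_annihilate fock_coeff_ket)
qed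

lemma cinner_creation_left: "cinner (creation i \<psi>) \<phi> = cinner \<psi> (annihilation i \<phi>)"
proof -
  have "cinner (creation i \<psi>) \<phi> =
      (\<Sum>\<^sub>\<infinity>w\<in>range (Cons i). fock_coeff (creation i \<psi>) w * cnj (fock_coeff \<phi> w))"
    unfolding cinner_def
    by (rule infsum_cong_neutral)
      (auto simp: creation.rep_eq fock_coeff_create image_iff neq_Nil_conv)
  also have "\<dots> = (\<Sum>\<^sub>\<infinity>w. fock_coeff (creation i \<psi>) (i # w) * cnj (fock_coeff \<phi> (i # w)))"
    by (subst infsum_reindex) (auto simp: o_def)
  also have "\<dots> = cinner \<psi> (annihilation i \<phi>)"
    unfolding cinner_def
    by (intro infsum_cong)
      (simp add: creation.rep_eq annihilation.rep_eq fock_coeff_create fock_coeff_annihilate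
        fock_coeff_outside)
  finally show ?thesis .
qed

text \<open>The norm of the type of bounded linear maps is the operator norm.\<close>

definition position_op :: "nat \<Rightarrow> fock \<Rightarrow>\<^sub>L fock" where
  "position_op i = annihilation i + creation i"

definition is_vacuum_distribution :: "(fock \<Rightarrow>\<^sub>L fock) \<Rightarrow> real measure \<Rightarrow> bool" where
  "is_vacuum_distribution T \<mu> \<longleftrightarrow>
     real_distribution \<mu> \<and> (\<exists>K. compact K \<and> (AE x in \<mu>. x \<in> K)) \<and>
     (\<forall>p. complex_of_real (\<integral>x. x ^ p \<partial>\<mu>) = cinner ((blinfun_apply T ^^ p) vacuum) vacuum)"

definition vacuum_distribution :: "(fock \<Rightarrow>\<^sub>L fock) \<Rightarrow> real measure" where
  "vacuum_distribution T = (THE \<mu>. is_vacuum_distribution T \<mu>)"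

definition atoms :: "real measure \<Rightarrow> real set" where
  "atoms \<mu> = {x. measure \<mu> {x} \<noteq> 0}"

text \<open>The recursion starts at index 1; the value at 0 is that of the zero operator.\<close>

fun atom_set :: "nat \<Rightarrow> real set" where
  "atom_set 0 = {0}"
| "atom_set (Suc 0) = {1, -1}"
| "atom_set (Suc (Suc k)) =
     (\<Union>r\<in>atom_set (Suc k). {(r + sqrt (r\<^sup>2 + 4)) / 2, (r - sqrt (r\<^sup>2 + 4)) / 2})"

end

theory Submission
  imports Defs
begin

text \<open>
  Everything rests on Boole's transformation \<open>b(x) = x - 1/x\<close>. The recursion for the sets of atoms
  adjoins the two solutions of \<open>b(x) = r\<close>, so \<open>atom_set n\<close> consists of the points that reach \<open>0\<close> for
  the first time at the \<open>n\<close>-th iterate of \<open>b\<close>.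

  Write \<open>S\<close> for the sum of the position operators over a finite set \<open>I\<close> of \<open>n\<close> modes. In the canonical
  basis, \<open>S\<close> is the adjacency operator of the graph on words in which \<open>w\<close> and \<open>k # w\<close> are joined for
  \<open>k \<in> I\<close>. For \<open>x \<in> atom_set n\<close> give the \<open>j\<close>-th smallest mode of \<open>I\<close> the weight \<open>1 / b\<^sup>j\<^sup>-\<^sup>1(x)\<close> and a word
  the product of its weights. The weights telescope: those of the modes below \<open>h\<close> add up to
  \<open>x - b\<^sup>r(x)\<close>, where \<open>r\<close> is the number of these modes. If \<open>h \<in> I\<close> heads the word, removing it multiplies
  the weight by exactly \<open>b\<^sup>r(x)\<close>, so the sum over all neighbours of the word is \<open>x\<close> times its weight; at
  the vacuum the sum is \<open>x - b\<^sup>n(x) = x\<close>. Thus \<open>x\<close> is an eigenvalue of \<open>S\<close>, with an eigenvector supported on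
  the words over \<open>I\<close> (lemma \<open>position_sum_eigenvector\<close>).

  For the norm, take the largest \<open>x\<close>. Its first \<open>n\<close> iterates are positive, so the word weights are
  positive. Modes outside \<open>I\<close> may be given weight \<open>1\<close>: such a mode is never removed from the
  head of a word, which only lowers the sum over the neighbours, so the weights become superharmonic
  for \<open>x\<close> on the whole graph, and Schur's test gives
  \<open>\<parallel>S\<parallel> \<le> x\<close> (\<open>norm_position_sum_le\<close>). The eigenvector gives the converse.

  For the atoms, the vacuum is expanded in these eigenvectors. All of them have vacuum coefficient
  \<open>1\<close>, so nonnegative coefficients in the expansion are the masses of the vacuum distribution at the
  eigenvalues. They are found by running \<open>b\<close> backwards as a Markov chain from \<open>0\<close>, choosing at each step
  between the two preimages so that \<open>1/x\<close> has conditional mean \<open>0\<close>; then the weight of every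
  nonempty word averages to \<open>0\<close> (\<open>expectation_prod_inverse_boole\<close>). Finally, moments determine a
  finitely supported distribution among compactly supported ones, because the square of a polynomial
  that vanishes on the support integrates to \<open>0\<close> (\<open>real_distribution_eqI_moments\<close>).
\<close>

section \<open>Boole's transformation and the sets of atoms\<close>

definition boole :: "real \<Rightarrow> real" where
  "boole x = x - 1 / x"

definition boole_pos :: "real \<Rightarrow> real" where
  "boole_pos r = (r + sqrt (r\<^sup>2 + 4)) / 2"

definition boole_neg :: "real \<Rightarrow> real" where
  "boole_neg r = (r - sqrt (r\<^sup>2 + 4)) / 2"

lemma boole_pos_greater_0: "0 < boole_pos r"
proof -
  have "\<bar>r\<bar> < sqrt (r\<^sup>2 + 4)"
    by (rule real_less_rsqrt) simp
  then show ?thesis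
    by (simp add: boole_pos_def)
qed

lemma boole_neg_eq: "boole_neg r = - 1 / boole_pos r"
proof -
  have "boole_neg r * boole_pos r = (r\<^sup>2 - (sqrt (r\<^sup>2 + 4))\<^sup>2) / 4"
    unfolding boole_neg_def boole_pos_def by (simp add: power2_eq_square algebra_simps)
  also have "\<dots> = -1"
    by simp
  finally show ?thesis
    using boole_pos_greater_0[of r] by (simp add: field_simps)
qed

lemma boole_boole_pos: "boole (boole_pos r) = r"
proof -
  have "boole_pos r + boole_neg r = r"
    unfolding boole_neg_def boole_pos_def by (simp add: add_divide_distrib diff_divide_distrib)
  then show ?thesis
    unfolding boole_def by (simp add: boole_neg_eq)
qed

lemma boole_boole_neg: "boole (boole_neg r) = r"
  using boole_boole_pos[of r] boole_pos_greater_0[of r]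
  by (simp add: boole_neg_eq boole_def)

lemma boole_eq_iff:
  assumes "x \<noteq> 0"
  shows "boole x = r \<longleftrightarrow> x = boole_pos r \<or> x = boole_neg r"
proof
  assume x: "boole x = r"
  have "boole x = boole (boole_pos r)"
    using x by (simp add: boole_boole_pos)
  then have "(x - boole_pos r) * (x + 1 / boole_pos r) = 0"
    using assms boole_pos_greater_0[of r] by (simp add: boole_def field_simps)
  then show "x = boole_pos r \<or> x = boole_neg r"
    by (auto simp: boole_neg_eq)
qed (auto simp: boole_boole_pos boole_boole_neg)

lemma boole_mono: "0 < x \<Longrightarrow> x \<le> y \<Longrightarrow> boole x \<le> boole y"
  unfolding boole_def by (intro diff_mono divide_left_mono) auto

lemma atom_set_Suc: "atom_set (Suc n) = (\<Union>r\<in>atom_set n. {boole_pos r, boole_neg r})"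
  by (cases n) (auto simp: boole_pos_def boole_neg_def)

text \<open>
  This turns the recursion around: membership is decided by applying one forward step of
  \<open>boole\<close> rather than by choosing among square roots. The point \<open>0\<close> must be excluded because
  \<open>boole 0 = 0\<close> under the convention \<open>1 / 0 = 0\<close>.
\<close>

lemma mem_atom_set_Suc_iff: "x \<in> atom_set (Suc n) \<longleftrightarrow> x \<noteq> 0 \<and> boole x \<in> atom_set n"
proof -
  have nonzero: "boole_pos r \<noteq> 0 \<and> boole_neg r \<noteq> 0" for r
    using boole_pos_greater_0[of r] by (simp add: boole_neg_eq)
  have "x \<in> atom_set (Suc n) \<longleftrightarrow> (\<exists>r\<in>atom_set n. x = boole_pos r \<or> x = boole_neg r)"
    unfolding atom_set_Suc by blast
  also have "\<dots> \<longleftrightarrow> (\<exists>r\<in>atom_set n. x \<noteq> 0 \<and> boole x = r)"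
    using nonzero boole_eq_iff by metis
  finally show ?thesis
    by blast
qed

lemma finite_atom_set: "finite (atom_set n)"
  by (induction n) (auto simp: atom_set_Suc simp del: atom_set.simps(2,3))

lemma atom_set_nonempty: "atom_set n \<noteq> {}"
  by (induction n) (auto simp: atom_set_Suc simp del: atom_set.simps(2,3))

lemma boole_funpow_eq_0: "x \<in> atom_set n \<Longrightarrow> (boole ^^ n) x = 0"
  by (induction n arbitrary: x)
    (auto simp: mem_atom_set_Suc_iff funpow_Suc_right simp del: atom_set.simps(2,3) funpow.simps(2))

lemma boole_funpow_nonzero: "x \<in> atom_set n \<Longrightarrow> k < n \<Longrightarrow> (boole ^^ k) x \<noteq> 0"
proof (induction n arbitrary: x k)
  case (Suc n)
  then show ?case
    by (cases k)
      (auto simp: mem_atom_set_Suc_iff funpow_Suc_right simp del: atom_set.simps(2,3) funpow.simps(2))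
qed simp

text \<open>
  Since \<open>boole\<close> is increasing on the positive axis, it takes the largest atom to the largest atom of
  the preceding set. Hence the whole forward orbit of the largest atom stays positive until it reaches
  \<open>0\<close>, which makes the eigenvector for this eigenvalue positive.
\<close>

lemma Max_atom_set_Suc:
  "0 < Max (atom_set (Suc n))" "boole (Max (atom_set (Suc n))) = Max (atom_set n)"
proof -
  let ?x = "Max (atom_set (Suc n))" and ?r = "Max (atom_set n)"
  have "boole_pos ?r \<in> atom_set (Suc n)"
    using Max_in[OF finite_atom_set[of n] atom_set_nonempty[of n]] by (auto simp: atom_set_Suc)
  then have le: "boole_pos ?r \<le> ?x"
    by (intro Max_ge finite_atom_set)
  then show "0 < ?x"
    using boole_pos_greater_0[of ?r] by linarith
  have "?x \<in> atom_set (Suc n)"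
    by (intro Max_in finite_atom_set atom_set_nonempty)
  then have "boole ?x \<le> ?r"
    by (intro Max_ge finite_atom_set) (simp add: mem_atom_set_Suc_iff del: atom_set.simps(2,3))
  moreover have "?r \<le> boole ?x"
    using boole_mono[OF boole_pos_greater_0 le] by (simp add: boole_boole_pos)
  ultimately show "boole ?x = ?r"
    by simp
qed

lemma boole_funpow_Max_atom_set_pos: "k < n \<Longrightarrow> 0 < (boole ^^ k) (Max (atom_set n))"
proof (induction n arbitrary: k)
  case (Suc n)
  then show ?case
    by (cases k)
      (auto simp: Max_atom_set_Suc funpow_Suc_right simp del: atom_set.simps(2,3) funpow.simps(2))
qed simp

lemma Max_atom_set_nonneg: "0 \<le> Max (atom_set n)"
  by (cases n) (auto simp: Max_atom_set_Suc less_imp_le simp del: atom_set.simps(2,3))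


section \<open>Sums of position operators as adjacency operators\<close>

text \<open>
  The graph whose adjacency operator is the sum of the position operators: creation of a mode in
  \<open>I\<close> adds it in front of a word, annihilation removes it.
\<close>

definition neighbours :: "nat set \<Rightarrow> nat list \<Rightarrow> nat list set" where
  "neighbours I w =
     {u. w \<in> mono_words \<and> u \<in> mono_words \<and> (\<exists>k\<in>I. u = k # w \<or> w = k # u)}"

lemma neighbours_sym: "u \<in> neighbours I w \<longleftrightarrow> w \<in> neighbours I u"
  by (auto simp: neighbours_def)

lemma neighbours_outside: "w \<notin> mono_words \<Longrightarrow> neighbours I w = {}"
  by (simp add: neighbours_def)

lemma neighbours_eq:
  assumes "w \<in> mono_words"
  shows "neighbours I w = (\<lambda>k. k # w) ` {k\<in>I. k # w \<in> mono_words} \<union>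
           (if w \<noteq> [] \<and> hd w \<in> I then {tl w} else {})"
  using assms by (cases w) (auto simp: neighbours_def Cons_mono_words)

lemma finite_neighbours: "finite I \<Longrightarrow> finite (neighbours I w)"
  by (cases "w \<in> mono_words") (auto simp: neighbours_eq neighbours_outside)

lemma sum_neighbours:
  fixes f :: "nat list \<Rightarrow> 'a::comm_monoid_add"
  assumes "finite I" "w \<in> mono_words"
  shows "(\<Sum>u\<in>neighbours I w. f u) =
           (\<Sum>k\<in>{k\<in>I. k # w \<in> mono_words}. f (k # w)) + (if w \<noteq> [] \<and> hd w \<in> I then f (tl w) else 0)"
proof -
  have "tl w \<noteq> k # w" for k
    by (metis impossible_Cons length_tl diff_le_self)
  then have "(\<lambda>k. k # w) ` {k\<in>I. k # w \<in> mono_words} \<inter>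
      (if w \<noteq> [] \<and> hd w \<in> I then {tl w} else {}) = {}"
    by auto
  then have "(\<Sum>u\<in>neighbours I w. f u) =
      (\<Sum>u\<in>(\<lambda>k. k # w) ` {k\<in>I. k # w \<in> mono_words}. f u) +
      (\<Sum>u\<in>(if w \<noteq> [] \<and> hd w \<in> I then {tl w} else {}). f u)"
    using assms by (simp only: neighbours_eq) (subst sum.union_disjoint; auto)
  also have "(\<Sum>u\<in>(\<lambda>k. k # w) ` {k\<in>I. k # w \<in> mono_words}. f u) =
      (\<Sum>k\<in>{k\<in>I. k # w \<in> mono_words}. f (k # w))"
    by (subst sum.reindex) (auto simp: inj_on_def)
  finally show ?thesis
    by auto
qed

lemma fock_coeff_sum: "fock_coeff (\<Sum>x\<in>A. f x) w = (\<Sum>x\<in>A. fock_coeff (f x) w)"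
  by (induction A rule: infinite_finite_induct) auto

lemma fock_coeff_position_sum:
  assumes "finite I"
  shows "fock_coeff ((\<Sum>k\<in>I. position_op k) \<psi>) w = (\<Sum>u\<in>neighbours I w. fock_coeff \<psi> u)"
proof (cases "w \<in> mono_words")
  case True
  have "fock_coeff ((\<Sum>k\<in>I. position_op k) \<psi>) w =
      (\<Sum>k\<in>I. fock_coeff \<psi> (k # w)) + (\<Sum>k\<in>I. if w \<noteq> [] \<and> hd w = k then fock_coeff \<psi> (tl w) else 0)"
    using True
    by (simp add: blinfun.sum_left fock_coeff_sum position_op_def blinfun.add_left annihilation.rep_eq
        creation.rep_eq fock_coeff_annihilate fock_coeff_create sum.distrib)
  also have "(\<Sum>k\<in>I. fock_coeff \<psi> (k # w)) = (\<Sum>k\<in>{k\<in>I. k # w \<in> mono_words}. fock_coeff \<psi> (k # w))"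
    using assms by (intro sum.mono_neutral_right) (auto simp: fock_coeff_outside)
  also have "(\<Sum>k\<in>I. if w \<noteq> [] \<and> hd w = k then fock_coeff \<psi> (tl w) else 0) =
      (if w \<noteq> [] \<and> hd w \<in> I then fock_coeff \<psi> (tl w) else 0)"
    using assms by (cases w) auto
  finally show ?thesis
    by (simp add: sum_neighbours[OF assms True])
qed (simp add: neighbours_outside fock_coeff_outside)


section \<open>Eigenvectors\<close>

text \<open>
  The weights depend on a mode only through its rank in \<open>I\<close>, so the eigenvalues depend on \<open>I\<close> only
  through \<open>card I\<close>. The weights are Green functions: for \<open>k \<in> I\<close> and \<open>x \<in> atom_set (card I)\<close>,
  \<open>mode_weight I x k\<close> is the vacuum matrix element of the resolvent at \<open>x\<close> of the sum of the position
  operators over the modes of \<open>I\<close> below \<open>k\<close>.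
\<close>

definition mode_weight :: "nat set \<Rightarrow> real \<Rightarrow> nat \<Rightarrow> real" where
  "mode_weight I x k = 1 / (boole ^^ card {j\<in>I. j < k}) x"

text \<open>
  A telescoping sum: one step of \<open>boole\<close> subtracts exactly the weight of the next mode.
\<close>

lemma sum_mode_weight:
  assumes "finite I"
  shows "(\<Sum>k\<in>{k\<in>I. k < h}. mode_weight I x k) = x - (boole ^^ card {k\<in>I. k < h}) x"
proof (induction h)
  case (Suc h)
  have fin: "finite {k\<in>I. k < h}"
    using assms by simp
  show ?case
  proof (cases "h \<in> I")
    case True
    then have eq: "{k\<in>I. k < Suc h} = insert h {k\<in>I. k < h}"
      by (auto simp: less_Suc_eq)
    show ?thesis
      using Suc boole_def[of "(boole ^^ card {k\<in>I. k < h}) x"]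
      unfolding eq by (simp add: sum.insert[OF fin] card_insert_disjoint[OF fin] mode_weight_def)
  next
    case False
    then have "{k\<in>I. k < Suc h} = {k\<in>I. k < h}"
      by (auto simp: less_Suc_eq)
    then show ?thesis
      using Suc by simp
  qed
qed simp

lemma sum_mode_weight_all:
  assumes "finite I" "x \<in> atom_set (card I)"
  shows "(\<Sum>k\<in>I. mode_weight I x k) = x"
proof -
  have "{k\<in>I. k < Suc (Max I)} = I"
    using assms(1) by (auto simp: less_Suc_eq_le)
  then show ?thesis
    using sum_mode_weight[OF assms(1), of x "Suc (Max I)"] boole_funpow_eq_0[OF assms(2)] by simp
qed

lemma rank_less_card:
  fixes I :: "nat set"
  shows "finite I \<Longrightarrow> k \<in> I \<Longrightarrow> card {j\<in>I. j < k} < card I"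
  by (rule psubset_card_mono) auto

definition word_weight :: "(nat \<Rightarrow> real) \<Rightarrow> nat list \<Rightarrow> real" where
  "word_weight c w = prod_list (map c w)"

lemma word_weight_simps [simp]:
  "word_weight c [] = 1" "word_weight c (k # w) = c k * word_weight c w"
  by (simp_all add: word_weight_def)

text \<open>
  The modes that may be put in front of a word headed by \<open>h\<close> are those below \<open>h\<close>, and their weights
  telescope. The defect \<open>(boole ^^ r) x\<close>, where \<open>r\<close> counts these modes, is cancelled by the contribution of the tail
  when \<open>h \<in> I\<close>, because the weight of \<open>h\<close> is its reciprocal; for the empty word it vanishes as
  \<open>x\<close> is an atom. For \<open>h \<notin> I\<close> it remains, whatever weight \<open>c\<close> gives to \<open>h\<close>.
\<close>

lemma sum_neighbours_word_weight:
  assumes "finite I" "\<And>k. k \<in> I \<Longrightarrow> 1 \<le> k" "x \<in> atom_set (card I)"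
    and w: "w \<in> mono_words" and c: "\<And>k. k \<in> I \<Longrightarrow> c k = mode_weight I x k"
  shows "(\<Sum>u\<in>neighbours I w. word_weight c u) =
     (if w = [] \<or> hd w \<in> I then x else x - (boole ^^ card {k\<in>I. k < hd w}) x) * word_weight c w"
proof -
  have *: "(\<Sum>u\<in>neighbours I w. word_weight c u) =
      (\<Sum>k\<in>{k\<in>I. k # w \<in> mono_words}. mode_weight I x k) * word_weight c w +
      (if w \<noteq> [] \<and> hd w \<in> I then word_weight c (tl w) else 0)"
    using assms by (simp add: sum_neighbours sum_distrib_right)
  show ?thesis
  proof (cases w)
    case Nil
    then have "{k\<in>I. k # w \<in> mono_words} = I"
      using assms(2) by (auto simp: Cons_mono_words)
    then show ?thesis
      unfolding * using Nil by (simp add: sum_mode_weight_all assms)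
  next
    case (Cons h v)
    then have "{k\<in>I. k # w \<in> mono_words} = {k\<in>I. k < h}"
      using assms(2) w by (auto simp: Cons_mono_words)
    then have **: "(\<Sum>u\<in>neighbours I w. word_weight c u) =
        (x - (boole ^^ card {k\<in>I. k < h}) x) * word_weight c w + (if h \<in> I then word_weight c v else 0)"
      unfolding * using Cons by (simp add: sum_mode_weight assms(1))
    have "word_weight c v = (boole ^^ card {k\<in>I. k < h}) x * word_weight c w" if "h \<in> I"
      using boole_funpow_nonzero[OF assms(3) rank_less_card[OF assms(1) that]]
      by (simp add: Cons c[OF that] mode_weight_def)
    moreover have "w \<noteq> []" "hd w = h"
      using Cons by simp_all
    ultimately show ?thesis
      unfolding ** by (simp add: algebra_simps)
  qed
qed

definition sub_words :: "nat set \<Rightarrow> nat list set" where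
  "sub_words I = {w \<in> mono_words. set w \<subseteq> I}"

lemma finite_sub_words: "finite I \<Longrightarrow> finite (sub_words I)"
proof -
  assume I: "finite I"
  have "sub_words I \<subseteq> {w. set w \<subseteq> I \<and> distinct w}"
    by (auto simp: sub_words_def mono_words_def strict_sorted_iff)
  then show ?thesis
    using finite_subset finite_subset_distinct[OF I] by blast
qed

definition eigenvector :: "nat set \<Rightarrow> real \<Rightarrow> fock" where
  "eigenvector I x = (\<Sum>w\<in>sub_words I. word_weight (mode_weight I x) w *\<^sub>R ket w)"

lemma fock_coeff_eigenvector:
  assumes "finite I"
  shows "fock_coeff (eigenvector I x) w =
    (if w \<in> sub_words I then of_real (word_weight (mode_weight I x) w) else 0)"
proof -
  have "fock_coeff (eigenvector I x) w =
      (\<Sum>v\<in>sub_words I. if w = v then of_real (word_weight (mode_weight I x) v) else 0)"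
    unfolding eigenvector_def fock_coeff_sum
    by (intro sum.cong) (auto simp: fock_coeff_ket sub_words_def)
  then show ?thesis
    by (simp add: finite_sub_words[OF assms])
qed

lemma eigenvector_nonzero: "finite I \<Longrightarrow> eigenvector I x \<noteq> 0"
  using fock_coeff_eigenvector[of I x "[]"] by (auto simp: sub_words_def)

lemma position_sum_eigenvector:
  assumes "finite I" "\<And>k. k \<in> I \<Longrightarrow> 1 \<le> k" "x \<in> atom_set (card I)"
  shows "(\<Sum>k\<in>I. position_op k) (eigenvector I x) = x *\<^sub>R eigenvector I x"
proof (rule fock_eqI)
  fix w
  let ?c = "mode_weight I x"
  have nb: "u \<in> sub_words I \<longleftrightarrow> w \<in> sub_words I" if "u \<in> neighbours I w" for u
    using that by (auto simp: neighbours_def sub_words_def)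
  show "fock_coeff ((\<Sum>k\<in>I. position_op k) (eigenvector I x)) w = fock_coeff (x *\<^sub>R eigenvector I x) w"
  proof (cases "w \<in> sub_words I")
    case True
    then have w: "w \<in> mono_words" "w = [] \<or> hd w \<in> I"
      by (auto simp: sub_words_def) (use hd_in_set in blast)
    have "fock_coeff ((\<Sum>k\<in>I. position_op k) (eigenvector I x)) w =
        (\<Sum>u\<in>neighbours I w. of_real (word_weight ?c u))"
      unfolding fock_coeff_position_sum[OF assms(1)]
      by (intro sum.cong refl) (simp add: fock_coeff_eigenvector[OF assms(1)] nb True)
    also have "\<dots> = of_real (x * word_weight ?c w)"
      using w by (simp only: of_real_sum[symmetric] sum_neighbours_word_weight[OF assms] if_True)
    finally show ?thesis
      by (simp add: fock_coeff_eigenvector[OF assms(1)] True)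
  next
    case False
    then show ?thesis
      by (simp add: fock_coeff_position_sum[OF assms(1)] fock_coeff_eigenvector[OF assms(1)] nb)
  qed
qed


section \<open>The operator norm\<close>

text \<open>
  Schur's test for the adjacency operator of a locally finite graph: by the Cauchy-Schwarz
  inequality with the weights \<open>p\<close>, a positive superharmonic function bounds the operator. It is stated for
  partial sums, so that no summability has to be discussed.
\<close>

lemma schur_test:
  fixes N :: "'a \<Rightarrow> 'a set" and p :: "'a \<Rightarrow> real" and f :: "'a \<Rightarrow> complex"
  assumes fin: "\<And>w. finite (N w)" and sym: "\<And>u w. u \<in> N w \<longleftrightarrow> w \<in> N u"
    and pos: "\<And>w. 0 < p w" and super: "\<And>w. (\<Sum>u\<in>N w. p u) \<le> R * p w"
    and R: "0 \<le> R" and F: "finite F"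
  shows "(\<Sum>w\<in>F. (cmod (\<Sum>u\<in>N w. f u))\<^sup>2) \<le> R\<^sup>2 * (\<Sum>u\<in>(\<Union>w\<in>F. N w). (cmod (f u))\<^sup>2)"
proof -
  let ?G = "\<Union>w\<in>F. N w"
  have G: "finite ?G"
    using F fin by auto
  have "(\<Sum>w\<in>F. (cmod (\<Sum>u\<in>N w. f u))\<^sup>2) \<le> (\<Sum>w\<in>F. \<Sum>u\<in>N w. R * p w * ((cmod (f u))\<^sup>2 / p u))"
  proof (rule sum_mono)
    fix w
    have "cmod (\<Sum>u\<in>N w. f u) \<le> (\<Sum>u\<in>N w. sqrt (p u) * (cmod (f u) / sqrt (p u)))"
      using norm_sum[of f "N w"] pos by (simp add: order_less_imp_not_eq2)
    then have "(cmod (\<Sum>u\<in>N w. f u))\<^sup>2 \<le> (\<Sum>u\<in>N w. sqrt (p u) * (cmod (f u) / sqrt (p u)))\<^sup>2"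
      by (rule power_mono) simp
    also have "\<dots> \<le> (\<Sum>u\<in>N w. (sqrt (p u))\<^sup>2) * (\<Sum>u\<in>N w. (cmod (f u) / sqrt (p u))\<^sup>2)"
      by (rule Cauchy_Schwarz_ineq_sum)
    also have "\<dots> = (\<Sum>u\<in>N w. p u) * (\<Sum>u\<in>N w. (cmod (f u))\<^sup>2 / p u)"
      using pos by (simp add: power_divide less_imp_le)
    also have "\<dots> \<le> R * p w * (\<Sum>u\<in>N w. (cmod (f u))\<^sup>2 / p u)"
      by (intro mult_right_mono super sum_nonneg divide_nonneg_nonneg) (simp_all add: pos less_imp_le)
    finally show "(cmod (\<Sum>u\<in>N w. f u))\<^sup>2 \<le> (\<Sum>u\<in>N w. R * p w * ((cmod (f u))\<^sup>2 / p u))"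
      by (simp add: sum_distrib_left)
  qed
  also have "\<dots> = (\<Sum>w\<in>F. \<Sum>u\<in>{u\<in>?G. u \<in> N w}. R * p w * ((cmod (f u))\<^sup>2 / p u))"
    by (intro sum.cong) auto
  also have "\<dots> = (\<Sum>u\<in>?G. \<Sum>w\<in>{w\<in>F. u \<in> N w}. R * p w * ((cmod (f u))\<^sup>2 / p u))"
    by (rule sum.swap_restrict[OF F G])
  also have "\<dots> \<le> (\<Sum>u\<in>?G. R\<^sup>2 * (cmod (f u))\<^sup>2)"
  proof (rule sum_mono)
    fix u
    have "(\<Sum>w\<in>{w\<in>F. u \<in> N w}. p w) \<le> (\<Sum>w\<in>N u. p w)"
      using sym fin pos by (intro sum_mono2) (auto simp: less_imp_le)
    also note super[of u]
    finally have "R * (\<Sum>w\<in>{w\<in>F. u \<in> N w}. p w) * ((cmod (f u))\<^sup>2 / p u) \<le>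
        R * (R * p u) * ((cmod (f u))\<^sup>2 / p u)"
      using R pos[of u] by (intro mult_right_mono mult_left_mono) auto
    also have "\<dots> = R\<^sup>2 * (cmod (f u))\<^sup>2"
      using pos[of u] by (simp add: power2_eq_square)
    finally show "(\<Sum>w\<in>{w\<in>F. u \<in> N w}. R * p w * ((cmod (f u))\<^sup>2 / p u)) \<le> R\<^sup>2 * (cmod (f u))\<^sup>2"
      by (simp only: sum_distrib_right sum_distrib_left)
  qed
  finally show ?thesis
    by (simp add: sum_distrib_left)
qed

lemma norm_position_sum_le:
  assumes I: "finite I" "\<And>k. k \<in> I \<Longrightarrow> 1 \<le> k"
  shows "norm (\<Sum>k\<in>I. position_op k) \<le> Max (atom_set (card I))"
proof (rule norm_blinfun_bound)
  let ?R = "Max (atom_set (card I))" and ?S = "\<Sum>k\<in>I. position_op k"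
  have R: "?R \<in> atom_set (card I)"
    by (intro Max_in finite_atom_set atom_set_nonempty)
  \<comment> \<open>Weight \<open>1\<close> outside \<open>I\<close> serves only positivity: such modes are never added or removed.\<close>
  let ?p = "word_weight (\<lambda>k. if k \<in> I then mode_weight I ?R k else 1)"
  have p_pos: "0 < ?p w" for w
  proof (induction w)
    case (Cons k w)
    then show ?case
      using boole_funpow_Max_atom_set_pos[OF rank_less_card[OF I(1), of k]]
      by (auto simp: mode_weight_def)
  qed simp
  have rank_nonneg: "0 \<le> (boole ^^ card {k\<in>I. k < h}) ?R" for h
  proof (cases "card {k\<in>I. k < h} < card I")
    case True
    then show ?thesis
      by (intro less_imp_le boole_funpow_Max_atom_set_pos)
  next
    case False
    then have "card {k\<in>I. k < h} = card I"
      using card_mono[of I "{k\<in>I. k < h}"] I(1) by auto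
    then show ?thesis
      using boole_funpow_eq_0[OF R] by simp
  qed
  have super: "(\<Sum>u\<in>neighbours I w. ?p u) \<le> ?R * ?p w" for w
  proof (cases "w \<in> mono_words")
    case True
    have "(\<Sum>u\<in>neighbours I w. ?p u) =
        (if w = [] \<or> hd w \<in> I then ?R else ?R - (boole ^^ card {k\<in>I. k < hd w}) ?R) * ?p w"
      by (rule sum_neighbours_word_weight[OF I R True]) simp_all
    also have "\<dots> \<le> ?R * ?p w"
      using p_pos[of w] rank_nonneg[of "hd w"] by (intro mult_right_mono) auto
    finally show ?thesis .
  next
    case False
    then show ?thesis
      using p_pos[of w] Max_atom_set_nonneg[of "card I"] by (simp add: neighbours_outside)
  qed
  show "0 \<le> ?R"
    by (rule Max_atom_set_nonneg)
  show "norm (?S \<psi>) \<le> ?R * norm \<psi>" for \<psi>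
  proof (rule norm_fock_leI)
    fix F :: "nat list set"
    assume F: "finite F"
    have "(\<Sum>w\<in>F. (cmod (fock_coeff (?S \<psi>) w))\<^sup>2) \<le>
        ?R\<^sup>2 * (\<Sum>u\<in>(\<Union>w\<in>F. neighbours I w). (cmod (fock_coeff \<psi> u))\<^sup>2)"
      unfolding fock_coeff_position_sum[OF I(1)]
      by (rule schur_test[where p = ?p])
        (use F p_pos super neighbours_sym finite_neighbours[OF I(1)] Max_atom_set_nonneg in auto)
    also have "\<dots> \<le> ?R\<^sup>2 * (norm \<psi>)\<^sup>2"
      using F finite_neighbours[OF I(1)] by (intro mult_left_mono sum_coeff_le_norm) auto
    finally show "(\<Sum>w\<in>F. (cmod (fock_coeff (?S \<psi>) w))\<^sup>2) \<le> (?R * norm \<psi>)\<^sup>2"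
      by (simp add: power_mult_distrib)
  qed (simp add: Max_atom_set_nonneg)
qed

theorem norm_position_sum:
  assumes I: "finite I" "\<And>k. k \<in> I \<Longrightarrow> 1 \<le> k"
  shows "norm (\<Sum>k\<in>I. position_op k) = Max (atom_set (card I))"
proof (rule antisym)
  let ?R = "Max (atom_set (card I))" and ?S = "\<Sum>k\<in>I. position_op k"
  show "norm ?S \<le> ?R"
    by (rule norm_position_sum_le[OF I])
  have "?R * norm (eigenvector I ?R) = norm (?S (eigenvector I ?R))"
    by (subst position_sum_eigenvector[OF I])
      (auto intro!: Max_in finite_atom_set atom_set_nonempty simp: Max_atom_set_nonneg)
  also have "\<dots> \<le> norm ?S * norm (eigenvector I ?R)"
    by (rule norm_blinfun)
  finally show "?R \<le> norm ?S"
    using eigenvector_nonzero[OF I(1), of ?R] by simp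
qed


section \<open>The spectral measure of the vacuum\<close>

text \<open>
  The two preimages \<open>x\<close> of \<open>r\<close> under \<open>boole\<close> have product \<open>-1\<close>, so the branch probabilities
  \<open>x\<^sup>2 / (x\<^sup>2 + 1)\<close> add up to \<open>1\<close>, and they give \<open>1 / x\<close> the mean \<open>0\<close>. They are the reciprocals of the
  derivative \<open>1 + 1 / x\<^sup>2\<close> of \<open>boole\<close>; thus the mass of an atom is the residue of
  the reciprocal of the \<open>n\<close>-th iterate of \<open>boole\<close>, that is, of the Cauchy transform of the vacuum distribution.
\<close>

fun atom_pmf :: "nat \<Rightarrow> real pmf" where
  "atom_pmf 0 = return_pmf 0"
| "atom_pmf (Suc n) = bind_pmf (atom_pmf n) (\<lambda>r.
     map_pmf (\<lambda>b. if b then boole_pos r else boole_neg r)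
       (bernoulli_pmf ((boole_pos r)\<^sup>2 / ((boole_pos r)\<^sup>2 + 1))))"

lemma branch_prob:
  "0 < (boole_pos r)\<^sup>2 / ((boole_pos r)\<^sup>2 + 1)" "(boole_pos r)\<^sup>2 / ((boole_pos r)\<^sup>2 + 1) < 1"
  using boole_pos_greater_0[of r] by (simp_all add: pos_add_strict)

lemma set_atom_pmf: "set_pmf (atom_pmf n) = atom_set n"
proof (induction n)
  case (Suc n)
  have "set_pmf (bernoulli_pmf ((boole_pos r)\<^sup>2 / ((boole_pos r)\<^sup>2 + 1))) = UNIV" for r
    using branch_prob[of r] by (intro set_pmf_bernoulli) auto
  then show ?case
    by (simp add: Suc atom_set_Suc UNIV_bool insert_commute del: atom_set.simps(2,3))
qed simp

lemma expectation_atom_pmf_Suc: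
  fixes f :: "real \<Rightarrow> real"
  defines "q \<equiv> \<lambda>r. (boole_pos r)\<^sup>2 / ((boole_pos r)\<^sup>2 + 1)"
  shows "measure_pmf.expectation (atom_pmf (Suc n)) f =
    measure_pmf.expectation (atom_pmf n) (\<lambda>r. q r * f (boole_pos r) + (1 - q r) * f (boole_neg r))"
proof -
  have "measure_pmf.expectation (atom_pmf (Suc n)) f =
      (\<Sum>r\<in>atom_set n. pmf (atom_pmf n) r *\<^sub>R measure_pmf.expectation
        (map_pmf (\<lambda>b. if b then boole_pos r else boole_neg r) (bernoulli_pmf (q r))) f)"
    unfolding atom_pmf.simps q_def
    by (rule pmf_expectation_bind[OF finite_atom_set]) (auto simp: set_atom_pmf)
  also have "\<dots> = (\<Sum>r\<in>atom_set n. pmf (atom_pmf n) r *\<^sub>R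
      (q r * f (boole_pos r) + (1 - q r) * f (boole_neg r)))"
    using branch_prob by (intro sum.cong refl arg_cong2[where f = scaleR]) (simp add: q_def less_imp_le)
  also have "\<dots> = measure_pmf.expectation (atom_pmf n)
      (\<lambda>r. q r * f (boole_pos r) + (1 - q r) * f (boole_neg r))"
    by (rule integral_measure_pmf[symmetric]) (simp_all add: finite_atom_set set_atom_pmf)
  finally show ?thesis .
qed

text \<open>
  The reason for the choice of the branch probabilities. Condition on \<open>boole x\<close>: all factors with
  \<open>k \<ge> 1\<close> depend on \<open>boole x\<close> alone, and the factor \<open>1 / x\<close> for \<open>k = 0\<close> has conditional mean \<open>0\<close>. Without that factor, the product is one of the same kind
  for the preceding distribution.
\<close>

lemma expectation_prod_inverse_boole:
  "B \<subseteq> {..<n} \<Longrightarrow> measure_pmf.expectation (atom_pmf n) (\<lambda>x. \<Prod>k\<in>B. 1 / (boole ^^ k) x) =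
    (if B = {} then 1 else 0)"
proof (induction n arbitrary: B)
  case 0
  then show ?case
    by simp
next
  case (Suc n)
  let ?B = "{k. Suc k \<in> B}"
  have B': "?B \<subseteq> {..<n}"
    using Suc.prems by auto
  have fin: "finite ?B"
    by (rule finite_subset[OF B']) simp
  have B: "B = (if 0 \<in> B then {0} else {}) \<union> Suc ` ?B"
    by (auto simp: image_iff) (metis not0_implies_Suc)+
  have split: "(\<Prod>k\<in>B. 1 / (boole ^^ k) x) =
      (if 0 \<in> B then 1 / x else 1) * (\<Prod>k\<in>?B. 1 / (boole ^^ k) (boole x))" for x
  proof -
    have "(\<Prod>k\<in>B. 1 / (boole ^^ k) x) =
        (\<Prod>k\<in>(if 0 \<in> B then {0} else {}). 1 / (boole ^^ k) x) * (\<Prod>k\<in>Suc ` ?B. 1 / (boole ^^ k) x)"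
      using fin by (subst B, subst prod.union_disjoint) auto
    also have "(\<Prod>k\<in>Suc ` ?B. 1 / (boole ^^ k) x) = (\<Prod>k\<in>?B. 1 / (boole ^^ k) (boole x))"
      by (subst prod.reindex) (auto simp: funpow_Suc_right simp del: funpow.simps(2))
    finally show ?thesis
      by simp
  qed
  let ?q = "\<lambda>r. (boole_pos r)\<^sup>2 / ((boole_pos r)\<^sup>2 + 1)"
  \<comment> \<open>With \<open>y = boole_pos r\<close> and \<open>boole_neg r = -1/y\<close>, both terms are \<open>y / (y\<^sup>2 + 1)\<close> up to sign.\<close>
  have mean: "?q r * (1 / boole_pos r) + (1 - ?q r) * (1 / boole_neg r) = 0" for r
    using boole_pos_greater_0[of r]
    by (simp add: boole_neg_eq field_simps power2_eq_square add_pos_pos order_less_imp_not_eq2)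
  have "measure_pmf.expectation (atom_pmf (Suc n)) (\<lambda>x. \<Prod>k\<in>B. 1 / (boole ^^ k) x) =
      measure_pmf.expectation (atom_pmf n)
        (\<lambda>r. (if 0 \<in> B then ?q r * (1 / boole_pos r) + (1 - ?q r) * (1 / boole_neg r) else 1) *
          (\<Prod>k\<in>?B. 1 / (boole ^^ k) r))"
    unfolding expectation_atom_pmf_Suc split boole_boole_pos boole_boole_neg
    by (rule Bochner_Integration.integral_cong) (auto simp: algebra_simps)
  also have "\<dots> = (if B = {} then 1 else 0)"
  proof (cases "0 \<in> B")
    case True
    then show ?thesis
      unfolding mean by auto
  next
    case False
    then have "?B = {} \<longleftrightarrow> B = {}"
      using B by auto
    then show ?thesis
      using Suc.IH[OF B'] False by simp
  qed
  finally show ?case .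
qed

text \<open>
  For the modes \<open>1, \<dots>, n\<close> the rank of \<open>k\<close> is \<open>k - 1\<close>, so the coefficient at a word is the
  expectation of a product of reciprocal iterates, one for each letter.
\<close>

lemma vacuum_eq_sum_eigenvectors:
  "vacuum = (\<Sum>x\<in>atom_set n. pmf (atom_pmf n) x *\<^sub>R eigenvector {1..n} x)"
proof (rule fock_eqI)
  fix w
  show "fock_coeff vacuum w = fock_coeff (\<Sum>x\<in>atom_set n. pmf (atom_pmf n) x *\<^sub>R eigenvector {1..n} x) w"
  proof (cases "w \<in> sub_words {1..n}")
    case False
    then have "w \<noteq> []"
      by (auto simp: sub_words_def)
    then show ?thesis
      using False by (simp add: fock_coeff_sum fock_coeff_eigenvector vacuum_def fock_coeff_ket)
  next
    case True
    then have w: "set w \<subseteq> {1..n}" "distinct w"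
      by (auto simp: sub_words_def mono_words_def strict_sorted_iff)
    let ?B = "(\<lambda>k. k - 1) ` set w"
    have inj: "inj_on (\<lambda>k. k - 1) (set w)"
      by (rule inj_on_diff_nat) (use w(1) in auto)
    have "mode_weight {1..n} x k = 1 / (boole ^^ (k - 1)) x" if "k \<in> set w" for x k
    proof -
      have "{j \<in> {1..n}. j < k} = {1..<k}"
        using that w(1) by auto
      then show ?thesis
        by (simp add: mode_weight_def)
    qed
    then have weight: "word_weight (mode_weight {1..n} x) w = (\<Prod>k\<in>?B. 1 / (boole ^^ k) x)" for x
      using w(2) by (simp add: word_weight_def prod.distinct_set_conv_list[symmetric]
        prod.reindex[OF inj] del: One_nat_def)
    have "fock_coeff (\<Sum>x\<in>atom_set n. pmf (atom_pmf n) x *\<^sub>R eigenvector {1..n} x) w =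
        of_real (\<Sum>x\<in>atom_set n. pmf (atom_pmf n) x *\<^sub>R (\<Prod>k\<in>?B. 1 / (boole ^^ k) x))"
      unfolding weight[symmetric] using True by (simp add: fock_coeff_sum fock_coeff_eigenvector)
    also have "(\<Sum>x\<in>atom_set n. pmf (atom_pmf n) x *\<^sub>R (\<Prod>k\<in>?B. 1 / (boole ^^ k) x)) =
        measure_pmf.expectation (atom_pmf n) (\<lambda>x. \<Prod>k\<in>?B. 1 / (boole ^^ k) x)"
      by (rule integral_measure_pmf[symmetric]) (simp_all add: finite_atom_set set_atom_pmf)
    also have "\<dots> = (if w = [] then 1 else 0)"
      using w(1) by (subst expectation_prod_inverse_boole) fastforce+
    finally show ?thesis
      by (simp add: vacuum_def fock_coeff_ket)
  qed
qed

lemma vacuum_moment: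
  "cinner ((blinfun_apply (\<Sum>k = 1..n. position_op k) ^^ p) vacuum) vacuum =
     of_real (\<Sum>x\<in>atom_set n. pmf (atom_pmf n) x * x ^ p)"
proof -
  let ?S = "\<Sum>k = 1..n. position_op k"
  have eig: "?S (eigenvector {1..n} x) = x *\<^sub>R eigenvector {1..n} x" if "x \<in> atom_set n" for x
    using that by (intro position_sum_eigenvector) auto
  have "(blinfun_apply ?S ^^ p) vacuum =
      (\<Sum>x\<in>atom_set n. (pmf (atom_pmf n) x * x ^ p) *\<^sub>R eigenvector {1..n} x)"
  proof (induction p)
    case 0
    show ?case
      using vacuum_eq_sum_eigenvectors[of n] by simp
  next
    case (Suc p)
    then show ?case
      by (simp add: blinfun.sum_right blinfun.scaleR_right eig mult_ac del: One_nat_def)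
  qed
  then show ?thesis
    by (simp add: vacuum_def cinner_ket_right fock_coeff_sum fock_coeff_eigenvector)
       (simp add: sub_words_def)
qed


section \<open>Moments determine a finitely supported distribution\<close>

lemma AE_bounded_integrable_poly:
  fixes M :: "real measure" and q :: "real poly"
  assumes "real_distribution M" "compact K" "AE x in M. x \<in> K"
  shows "integrable M (poly q)"
proof -
  interpret real_distribution M
    by fact
  have "compact (poly q ` K)"
    using assms(2) by (intro compact_continuous_image continuous_intros)
  then obtain b where "\<And>x. x \<in> K \<Longrightarrow> norm (poly q x) \<le> b"
    by (metis compact_imp_bounded bounded_iff imageI)
  then have "AE x in M. norm (poly q x) \<le> b"
    using assms(3) by auto
  then show ?thesis
    by (rule integrable_const_bound) (simp add: borel_measurable_continuous_onI continuous_intros)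
qed

lemma integral_poly:
  fixes M :: "real measure" and q :: "real poly"
  assumes "real_distribution M" "compact K" "AE x in M. x \<in> K"
  shows "(\<integral>x. poly q x \<partial>M) = (\<Sum>i\<le>degree q. coeff q i * (\<integral>x. x ^ i \<partial>M))"
proof -
  have "poly (monom 1 i) = (\<lambda>x::real. x ^ i)" for i
    by (simp add: poly_monom fun_eq_iff)
  then have "integrable M (\<lambda>x. x ^ i)" for i
    using AE_bounded_integrable_poly[OF assms, of "monom 1 i"] by simp
  then show ?thesis
    by (simp add: poly_altdef)
qed

text \<open>
  On \<open>A\<close>, the polynomial that vanishes on \<open>A - {a}\<close> is a multiple of the indicator of \<open>a\<close>.
\<close>

lemma measure_singleton_from_integral:
  fixes M :: "real measure"
  assumes "real_distribution M" "finite A" "AE x in M. x \<in> A" "a \<in> A"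
  shows "(\<integral>x. poly (\<Prod>b\<in>A - {a}. [:-b, 1:]) x \<partial>M) = measure M {a} * (\<Prod>b\<in>A - {a}. a - b)"
proof -
  interpret real_distribution M
    by fact
  have "(\<integral>x. poly (\<Prod>b\<in>A - {a}. [:-b, 1:]) x \<partial>M) =
      (\<integral>x. indicator {a} x * (\<Prod>b\<in>A - {a}. a - b) \<partial>M)"
  proof (rule integral_cong_AE)
    show "AE x in M. poly (\<Prod>b\<in>A - {a}. [:-b, 1:]) x = indicator {a} x * (\<Prod>b\<in>A - {a}. a - b)"
      using assms(3)
    proof eventually_elim
      case (elim x)
      then show ?case
        using assms(2) by (auto simp: poly_prod indicator_def)
    qed
  qed (simp_all add: borel_measurable_continuous_onI continuous_intros)
  then show ?thesis
    by simp
qed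

text \<open>
  Compact support makes polynomials integrable, so equal moments give equal polynomial integrals. The
  square of the polynomial with root set \<open>A\<close> then forces \<open>N\<close> to live on \<open>A\<close>, where interpolation
  polynomials recover the masses of single points.
\<close>

lemma real_distribution_eqI_moments:
  fixes M N :: "real measure"
  assumes M: "real_distribution M" and N: "real_distribution N"
    and A: "finite A" "AE x in M. x \<in> A" and K: "compact K" "AE x in N. x \<in> K"
    and moments: "\<And>p. (\<integral>x. x ^ p \<partial>N) = (\<integral>x. x ^ p \<partial>M)"
  shows "N = M"
proof -
  interpret M: real_distribution M
    by fact
  interpret N: real_distribution N
    by fact
  have poly_eq: "(\<integral>x. poly q x \<partial>N) = (\<integral>x. poly q x \<partial>M)" for q
    using integral_poly[OF M finite_imp_compact[OF A(1)] A(2)] integral_poly[OF N K] moments by simp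
  have N_A: "AE x in N. x \<in> A"
  proof -
    let ?q = "(\<Prod>a\<in>A. [:-a, 1:])\<^sup>2"
    have "(\<integral>x. poly ?q x \<partial>M) = 0"
      by (rule integral_eq_zero_AE) (use A in \<open>auto simp: poly_power poly_prod\<close>)
    then have "AE x in N. poly ?q x = 0"
      using integral_nonneg_eq_0_iff_AE[OF AE_bounded_integrable_poly[OF N K, of ?q]] poly_eq[of ?q]
      by (simp add: poly_power)
    then show ?thesis
      by eventually_elim (use A in \<open>auto simp: poly_power poly_prod\<close>)
  qed
  have single: "measure N {a} = measure M {a}" if "a \<in> A" for a
  proof -
    have "(\<Prod>b\<in>A - {a}. a - b) \<noteq> 0"
      using A by auto
    then show ?thesis
      using measure_singleton_from_integral[OF M A that] measure_singleton_from_integral[OF N A(1) N_A that]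
        poly_eq[of "\<Prod>b\<in>A - {a}. [:-b, 1:]"] by simp
  qed
  have sum_single: "measure L B = (\<Sum>a\<in>A \<inter> B. measure L {a})"
    if L: "real_distribution L" "AE x in L. x \<in> A" and B: "B \<in> sets borel" for L B
  proof -
    interpret L: real_distribution L
      by fact
    have "A \<inter> B \<in> sets borel"
      using A(1) by (intro borel_closed finite_imp_closed) simp
    then have "measure L B = measure L (A \<inter> B)"
      using L(2) B by (intro L.finite_measure_eq_AE) auto
    also have "\<dots> = (\<Sum>a\<in>A \<inter> B. measure L {a})"
      using A(1) by (intro L.finite_measure_eq_sum_singleton) auto
    finally show ?thesis .
  qed
  show ?thesis
  proof (rule measure_eqI)
    fix B
    assume "B \<in> sets N"
    then have "measure N B = measure M B"
      using sum_single[OF N N_A, of B] sum_single[OF M A(2), of B] single by simp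
    then show "emeasure N B = emeasure M B"
      by (simp add: N.emeasure_eq_measure M.emeasure_eq_measure)
  qed simp
qed

lemma vacuum_distribution_position_sum:
  "vacuum_distribution (\<Sum>k = 1..n. position_op k) = distr (atom_pmf n) borel (\<lambda>x. x)"
proof -
  let ?M = "distr (atom_pmf n) borel (\<lambda>x. x)"
  have M: "real_distribution ?M"
    by (rule prob_space.real_distribution_distr[OF prob_space_measure_pmf]) simp
  have AE: "AE x in ?M. x \<in> atom_set n"
    using finite_imp_closed[OF finite_atom_set[of n]]
    by (subst AE_distr_iff) (auto simp: AE_measure_pmf_iff set_atom_pmf)
  have mom: "(\<integral>x. x ^ p \<partial>?M) = (\<Sum>x\<in>atom_set n. pmf (atom_pmf n) x * x ^ p)" for p
    by (subst integral_distr)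
      (auto intro!: integral_measure_pmf[OF finite_atom_set[of n], THEN trans] simp: set_atom_pmf)
  have "is_vacuum_distribution (\<Sum>k = 1..n. position_op k) ?M"
    unfolding is_vacuum_distribution_def vacuum_moment mom
    using M AE finite_imp_compact[OF finite_atom_set[of n]] by blast
  moreover have "N = ?M" if "is_vacuum_distribution (\<Sum>k = 1..n. position_op k) N" for N
  proof -
    from that obtain K where "real_distribution N" "compact K" "AE x in N. x \<in> K"
      and "\<And>p. of_real (\<integral>x. x ^ p \<partial>N) = complex_of_real (\<Sum>x\<in>atom_set n. pmf (atom_pmf n) x * x ^ p)"
      unfolding is_vacuum_distribution_def vacuum_moment by blast
    then show ?thesis
      using real_distribution_eqI_moments[OF M _ finite_atom_set AE, of N K] mom
      by (simp add: of_real_eq_iff del: of_real_sum)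
  qed
  ultimately show ?thesis
    unfolding vacuum_distribution_def by (rule the_equality)
qed

theorem atoms_vacuum_distribution:
  "atoms (vacuum_distribution (\<Sum>k = 1..n. position_op k)) = atom_set n"
proof -
  have "measure (distr (atom_pmf n) borel (\<lambda>x. x)) {x} = pmf (atom_pmf n) x" for x
    by (subst measure_distr) (auto simp: measure_pmf_single)
  then show ?thesis
    by (auto simp: atoms_def vacuum_distribution_position_sum set_atom_pmf[symmetric] set_pmf_iff
        simp del: One_nat_def)
qed

theorem proposition4p4:
  fixes i :: "nat \<Rightarrow> nat" and n m :: nat
  assumes "1 \<le> n" and "i 0 = 0" and "1 \<le> i 1"
    and "\<And>j. 1 \<le> j \<Longrightarrow> j < n \<Longrightarrow> i j < i (j + 1)"
    and "i n = m"
    and "\<exists>j\<in>{1..n}. i j \<noteq> i (j - 1) + 1"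
  shows "norm (\<Sum>h = 1..n. position_op (i h)) = Max (atom_set n) \<and>
         atoms (vacuum_distribution (\<Sum>k = 1..n. position_op k)) = atom_set n"
proof
  have less: "j < l \<Longrightarrow> l \<le> n \<Longrightarrow> 1 \<le> j \<Longrightarrow> i j < i l" for j l
  proof (induction l)
    case (Suc l)
    then show ?case
      using assms(4)[of l] by (cases "j = l") auto
  qed simp
  have inj: "inj_on i {1..n}"
    by (rule linorder_inj_onI) (use less in \<open>auto simp: less_imp_neq\<close>)
  have pos: "1 \<le> k" if "k \<in> i ` {1..n}" for k
    using that less[of 1] assms(3) by (force simp: le_less)
  have "(\<Sum>h = 1..n. position_op (i h)) = (\<Sum>k\<in>i ` {1..n}. position_op k)"
    by (simp add: sum.reindex[OF inj] del: One_nat_def)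
  then show "norm (\<Sum>h = 1..n. position_op (i h)) = Max (atom_set n)"
    using norm_position_sum[OF _ pos]
    by (simp only: finite_imageI finite_atLeastAtMost card_image[OF inj] card_atLeastAtMost diff_Suc_1)
  show "atoms (vacuum_distribution (\<Sum>k = 1..n. position_op k)) = atom_set n"
    by (rule atoms_vacuum_distribution)
qed

end
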